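(* Consider online scheduling of $n$ unit-weight jobs on $m$ identical machines, jobs arriving in index order with release times $r_1\le\dots\le r_n$ and processing times $p_j$ that are powers of $2$ (with $p_j\ge 1$). Let ALG be the static mechanism of the context, $c_j$ the completion time of job $j$ under ALG, $P_{\max}=\max_j p_j$, $n_i=|\{j: 2^i\le p_j<2^{i+1}\}|$ for $0\le i\le \log_2 P_{\max}$, and $n_{\max}=\max_i n_i$. Then the competitive ratio of ALG is $O(\log P_{\max}+\log n_{\max})$: there is an absolute constant $C$ such that $\sum_j c_j\le C\cdot\max\{1,\log_2 P_{\max}+\log_2 n_{\max}\}\cdot\mathrm{OPT}$, where $\mathrm{OPT}$ is the minimum total completion time over all (preemptive) schedules on $m$ machines respecting release times.
   Context: Define $S_0=\langle 1\rangle$, $S_k=S_{k-1}\|S_{k-1}\|\langle 2^k\rangle$ ($\|$ = concatenation), and $S_\infty$ the infinite sequence having every $S_k$ as a prefix ($S_\infty=\langle 1,1,2,1,1,2,4,1,1,2,\dots\rangle$). The timeline $[0,\infty)$ of every machine is statically divided into consecutive intervals starting at $0$ whose lengths are $S_\infty[1],S_\infty[2],\dots$. Static mechanism ALG: when job $j$ arrives, it occupies an (interval, machine) pair not occupied by any earlier job, with interval start $\ge r_j$ and interval length $\ge p_j$, choosing the earliest-starting such interval (any machine on which it is free); it starts at the start of that interval and completes at $c_j=\text{start}+p_j$, and the whole interval on that machine becomes occupied. *)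

theory Defs
  imports "HOL-Analysis.Analysis"
begin

section \<open>The static division of the timeline\<close>

fun S_seq :: "nat \<Rightarrow> nat list" where
  "S_seq 0 = [1]"
| "S_seq (Suc k) = S_seq k @ S_seq k @ [2 ^ Suc k]"

text \<open>Interval indices start at \<open>0\<close>. The list \<open>S_seq i\<close> has more than \<open>i\<close> entries, so it
  determines entry \<open>i\<close> of the infinite sequence; see \<open>S_seq_prefix_S_inf\<close>.\<close>

definition S_inf :: "nat \<Rightarrow> nat" where
  "S_inf i = S_seq i ! i"

definition interval_start :: "nat \<Rightarrow> nat" where
  "interval_start i = (\<Sum>l<i. S_inf l)"

lemma length_S_seq: "Suc (length (S_seq k)) = 2 ^ Suc k"
  by (induction k) auto

lemma less_length_S_seq: "k < length (S_seq k)"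
proof -
  have "Suc k < 2 ^ Suc k" by (rule less_exp)
  then show ?thesis using length_S_seq[of k] by linarith
qed

lemma length_S_seq_mono: "k \<le> l \<Longrightarrow> length (S_seq k) \<le> length (S_seq l)"
  by (rule lift_Suc_mono_le) auto

lemma S_seq_nth_mono: "k \<le> l \<Longrightarrow> i < length (S_seq k) \<Longrightarrow> S_seq l ! i = S_seq k ! i"
proof (induction l rule: dec_induct)
  case (step l)
  then have "i < length (S_seq l)" using length_S_seq_mono[of k l] by linarith
  then show ?case using step by (simp add: nth_append)
qed simp

lemma S_seq_prefix_S_inf: "i < length (S_seq k) \<Longrightarrow> S_seq k ! i = S_inf i"
  unfolding S_inf_def
  using S_seq_nth_mono[of k i i] S_seq_nth_mono[of i k i] less_length_S_seq[of i]
  by (cases "k \<le> i") auto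

section \<open>Instances\<close>

text \<open>Jobs are numbered \<open>1, \<dots>, n\<close>, in the order of their arrival.\<close>

definition valid_instance :: "nat \<Rightarrow> (nat \<Rightarrow> real) \<Rightarrow> (nat \<Rightarrow> nat) \<Rightarrow> bool" where
  "valid_instance n r p \<longleftrightarrow>
     (\<forall>j\<in>{1..n}. 0 \<le> r j) \<and>
     (\<forall>i\<in>{1..n}. \<forall>j\<in>{1..n}. i \<le> j \<longrightarrow> r i \<le> r j) \<and>
     (\<forall>j\<in>{1..n}. \<exists>k. p j = 2 ^ k)"

definition P_max :: "nat \<Rightarrow> (nat \<Rightarrow> nat) \<Rightarrow> nat" where
  "P_max n p = Max (p ` {1..n})"

definition class_size :: "nat \<Rightarrow> (nat \<Rightarrow> nat) \<Rightarrow> nat \<Rightarrow> nat" where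
  "class_size n p i = card {j \<in> {1..n}. 2 ^ i \<le> p j \<and> p j < 2 ^ (i + 1)}"

definition n_max :: "nat \<Rightarrow> (nat \<Rightarrow> nat) \<Rightarrow> nat" where
  "n_max n p = Max (class_size n p ` {i. real i \<le> log 2 (P_max n p)})"

section \<open>The static mechanism\<close>

text \<open>An assignment \<open>a\<close> maps each job to an interval index and a machine in \<open>{..<m}\<close>.\<close>

definition available ::
  "nat \<Rightarrow> (nat \<Rightarrow> real) \<Rightarrow> (nat \<Rightarrow> nat) \<Rightarrow> (nat \<Rightarrow> nat \<times> nat) \<Rightarrow> nat \<Rightarrow> (nat \<times> nat) set" where
  "available m r p a j =
     {(i, h). h < m \<and> r j \<le> real (interval_start i) \<and> p j \<le> S_inf i \<and>
              (\<forall>j'\<in>{1..<j}. a j' \<noteq> (i, h))}"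

text \<open>A relation rather than a function, because the machine is an arbitrary one among those
  on which the earliest interval is free.\<close>

definition alg_run ::
  "nat \<Rightarrow> nat \<Rightarrow> (nat \<Rightarrow> real) \<Rightarrow> (nat \<Rightarrow> nat) \<Rightarrow> (nat \<Rightarrow> nat \<times> nat) \<Rightarrow> bool" where
  "alg_run m n r p a \<longleftrightarrow>
     (\<forall>j\<in>{1..n}. a j \<in> available m r p a j \<and>
        (\<forall>q\<in>available m r p a j. interval_start (fst (a j)) \<le> interval_start (fst q)))"

definition alg_completion :: "(nat \<Rightarrow> nat) \<Rightarrow> (nat \<Rightarrow> nat \<times> nat) \<Rightarrow> nat \<Rightarrow> real" where
  "alg_completion p a j = real (interval_start (fst (a j))) + real (p j)"

lemma S_inf_long: "S_inf (2 ^ Suc k - 2) = 2 ^ k"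
proof -
  have len: "length (S_seq k) = 2 ^ Suc k - 1" using length_S_seq[of k] by linarith
  have "(2::nat) \<le> 2 ^ Suc k" by simp
  then have idx: "2 ^ Suc k - 2 = length (S_seq k) - 1" and "length (S_seq k) - 1 < length (S_seq k)"
    using len by linarith+
  moreover have "last (S_seq k) = 2 ^ k" by (cases k) auto
  moreover have "S_seq k \<noteq> []" using less_length_S_seq[of k] by auto
  ultimately show ?thesis using S_seq_prefix_S_inf[of "2 ^ Suc k - 2" k] by (simp add: last_conv_nth)
qed

lemma S_inf_pos: "1 \<le> S_inf i"
proof -
  have "\<forall>x\<in>set (S_seq k). 1 \<le> x" for k by (induction k) auto
  then show ?thesis unfolding S_inf_def using less_length_S_seq nth_mem by blast
qed

lemma le_interval_start: "i \<le> interval_start i"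
  unfolding interval_start_def using sum_mono[of "{..<i}" "\<lambda>_. 1" S_inf] S_inf_pos by simp

lemma available_nonempty:
  assumes "1 \<le> m"
  shows "available m r p a j \<noteq> {}"
proof -
  let ?B = "Max (insert 0 ((\<lambda>j'. fst (a j')) ` {1..<j}))"
  define k where "k = p j + nat \<lceil>r j\<rceil> + Suc ?B"
  let ?i = "2 ^ Suc k - 2 :: nat"
  have i: "k \<le> ?i" using less_exp[of k] k_def by simp
  have "p j \<le> S_inf ?i" unfolding S_inf_long using less_exp[of k] k_def by linarith
  moreover have "r j \<le> real (interval_start ?i)"
  proof -
    have "r j \<le> real (nat \<lceil>r j\<rceil>)" by linarith
    also have "\<dots> \<le> real (interval_start ?i)"
      using i le_interval_start[of ?i] k_def by linarith
    finally show ?thesis .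
  qed
  moreover have "a j' \<noteq> (?i, 0)" if "j' \<in> {1..<j}" for j'
  proof -
    have "fst (a j') \<le> ?B" using that by (intro Max_ge) auto
    then show ?thesis using i k_def by auto
  qed
  ultimately have "(?i, 0) \<in> available m r p a j" using assms by (auto simp: available_def)
  then show ?thesis by blast
qed

lemma alg_run_exists:
  assumes "1 \<le> m"
  shows "\<exists>a. alg_run m n r p a"
proof (induction n)
  case 0
  show ?case by (simp add: alg_run_def)
next
  case (Suc n)
  then obtain a where a: "alg_run m n r p a" by blast
  obtain q0 where "q0 \<in> available m r p a (Suc n)" using available_nonempty[OF assms] by blast
  then obtain q where q: "q \<in> available m r p a (Suc n)"
      "\<forall>q'. q' \<in> available m r p a (Suc n) \<longrightarrow> interval_start (fst q) \<le> interval_start (fst q')"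
    using ex_has_least_nat[of "\<lambda>q. q \<in> available m r p a (Suc n)" q0
      "\<lambda>q. interval_start (fst q)"] by blast
  have av: "available m r p (a(Suc n := q)) j = available m r p a j" if "j \<le> Suc n" for j
    using that by (auto simp: available_def)
  have "alg_run m (Suc n) r p (a(Suc n := q))"
    unfolding alg_run_def
  proof (intro ballI)
    fix j assume "j \<in> {1..Suc n}"
    then show "(a(Suc n := q)) j \<in> available m r p (a(Suc n := q)) j \<and>
      (\<forall>q'\<in>available m r p (a(Suc n := q)) j.
        interval_start (fst ((a(Suc n := q)) j)) \<le> interval_start (fst q'))"
      using a q av[of j] by (cases "j = Suc n") (auto simp: alg_run_def)
  qed
  then show ?case by blast
qed

section \<open>Preemptive schedules and the optimum\<close>

text \<open>A schedule \<open>\<sigma>\<close> gives the job, if any, that machine \<open>h\<close> runs at time \<open>t\<close>. Jobs may be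
  preempted and may migrate; \<open>processed\<close> is the amount of work done on job \<open>j\<close> up to time
  \<open>t\<close>. Values \<open>Some j\<close> for \<open>j\<close> outside \<open>{1..n}\<close> amount to idling, and processing a job
  beyond its completion is harmless.\<close>

type_synonym schedule = "nat \<Rightarrow> real \<Rightarrow> nat option"

definition processed :: "nat \<Rightarrow> schedule \<Rightarrow> nat \<Rightarrow> real \<Rightarrow> real" where
  "processed m \<sigma> j t = measure lebesgue {s \<in> {0..t}. \<exists>h<m. \<sigma> h s = Some j}"

definition feasible ::
  "nat \<Rightarrow> nat \<Rightarrow> (nat \<Rightarrow> real) \<Rightarrow> (nat \<Rightarrow> nat) \<Rightarrow> schedule \<Rightarrow> bool" where
  "feasible m n r p \<sigma> \<longleftrightarrow>
     (\<forall>j\<in>{1..n}.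
        (\<forall>h<m. {t. \<sigma> h t = Some j} \<in> sets lebesgue) \<and>
        (\<forall>h<m. \<forall>t. \<sigma> h t = Some j \<longrightarrow> r j \<le> t) \<and>
        (\<forall>h<m. \<forall>h'<m. \<forall>t. \<sigma> h t = Some j \<and> \<sigma> h' t = Some j \<longrightarrow> h = h') \<and>
        (\<exists>t\<ge>0. real (p j) \<le> processed m \<sigma> j t))"

definition completion :: "nat \<Rightarrow> (nat \<Rightarrow> nat) \<Rightarrow> schedule \<Rightarrow> nat \<Rightarrow> real" where
  "completion m p \<sigma> j = Inf {t. 0 \<le> t \<and> real (p j) \<le> processed m \<sigma> j t}"

definition OPT :: "nat \<Rightarrow> nat \<Rightarrow> (nat \<Rightarrow> real) \<Rightarrow> (nat \<Rightarrow> nat) \<Rightarrow> real" where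
  "OPT m n r p = Inf {\<Sum>j=1..n. completion m p \<sigma> j | \<sigma>. feasible m n r p \<sigma>}"

end

theory Submission
  imports Defs
begin

text \<open>A job of size \<open>2 ^ k\<close> misses a block \<open>S_q\<close> that starts after its release only if all
  intervals of length \<open>2 ^ k\<close> in the block are taken, and then the block carries, on every
  machine, volume at least \<open>2 ^ q\<close> of jobs of size at most \<open>2 ^ k\<close>. Let \<open>2 ^ K\<close> exceed the total
  processing time, with \<open>K = O(log P_max + log n_max)\<close>. By time \<open>4 (2 K + 1) t\<close> the mechanism has
  completed at least as many jobs as an arbitrary schedule has by time \<open>t\<close>: if
  \<open>t \<ge> (K + 1) 2 ^ K\<close>, then a block \<open>S_K\<close> starts in \<open>[t, 4 t]\<close>, and no job released by \<open>t\<close> can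
  miss it. Otherwise let \<open>2 ^ q\<close> be \<open>t\<close> rounded up to a power of two, and take a smallest job
  released by \<open>t\<close> that misses the second copy of \<open>S_q\<close>: the mechanism has then processed volume
  at least \<open>m t\<close>, no less than the other schedule by time \<open>t\<close>, in jobs that are no larger than
  those it still lacks.\<close>

section \<open>Blocks of the static division\<close>

text \<open>Each of the \<open>k + 1\<close> lengths \<open>2 ^ i\<close> with \<open>i <= k\<close>
  occurs \<open>2 ^ (k - i)\<close> times, so every length contributes the same total
  \<open>2 ^ k\<close>.\<close>

lemma sum_list_S_seq: "sum_list (S_seq k) = (k + 1) * 2 ^ k"
  by (induction k) (auto simp: algebra_simps)

text \<open>Blocks are tracked by position rather than as sublists, so that the halves of a block
  are again blocks and can be used in an induction.\<close>

definition is_block :: "nat \<Rightarrow> nat \<Rightarrow> bool" where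
  "is_block k b \<longleftrightarrow> (\<forall>i<length (S_seq k). S_inf (b + i) = S_seq k ! i)"

lemma is_block_0: "is_block k 0"
  by (simp add: is_block_def S_seq_prefix_S_inf)

lemma is_block_Suc:
  assumes "is_block (Suc k) b"
  shows "is_block k b" "is_block k (b + length (S_seq k))"
proof -
  have *: "S_inf (b + i) = S_seq (Suc k) ! i" if "i < length (S_seq (Suc k))" for i
    using assms that by (simp add: is_block_def)
  show "is_block k b"
    using * by (auto simp: is_block_def nth_append)
  show "is_block k (b + length (S_seq k))"
    unfolding is_block_def
  proof (intro allI impI)
    fix i assume "i < length (S_seq k)"
    then show "S_inf (b + length (S_seq k) + i) = S_seq k ! i"
      using *[of "length (S_seq k) + i"] by (simp add: nth_append add.assoc)
  qed
qed

lemma is_block_antimono: "k \<le> l \<Longrightarrow> is_block l b \<Longrightarrow> is_block k b"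
  by (induction l rule: dec_induct) (auto dest: is_block_Suc)

text \<open>Unlike the copy at time 0, this one starts at \<open>(k + 1) * 2 ^ k\<close>, so a
  suitable \<open>k\<close> places it after any given release time.\<close>

lemma is_block_second_copy: "is_block k (length (S_seq k))"
  using is_block_Suc(2)[OF is_block_0] by simp

lemma is_block_last:
  assumes "is_block k b"
  shows "S_inf (b + length (S_seq k) - 1) = 2 ^ k"
proof -
  have l: "0 < length (S_seq k)" using less_length_S_seq[of k] by linarith
  then have eq: "b + length (S_seq k) - 1 = b + (length (S_seq k) - 1)" by linarith
  have "S_inf (b + length (S_seq k) - 1) = S_seq k ! (length (S_seq k) - 1)"
    unfolding eq using assms l by (simp add: is_block_def)
  also have "\<dots> = last (S_seq k)" using l by (subst last_conv_nth) auto
  also have "\<dots> = 2 ^ k" by (cases k) auto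
  finally show ?thesis .
qed

lemma interval_start_Suc: "interval_start (Suc i) = interval_start i + S_inf i"
  by (simp add: interval_start_def)

lemma strict_mono_interval_start: "strict_mono interval_start"
proof (rule strict_monoI_Suc)
  show "interval_start i < interval_start (Suc i)" for i
    using S_inf_pos[of i] by (simp add: interval_start_Suc)
qed

lemma interval_start_add_block:
  assumes "is_block k b"
  shows "interval_start (b + length (S_seq k)) = interval_start b + (k + 1) * 2 ^ k"
proof -
  have "interval_start (b + l) = interval_start b + (\<Sum>i<l. S_inf (b + i))" for l
    by (induction l) (simp_all add: interval_start_Suc)
  moreover have "(\<Sum>i<length (S_seq k). S_inf (b + i)) = sum_list (S_seq k)"
    using assms by (simp add: is_block_def sum_list_sum_nth atLeast0LessThan)
  ultimately show ?thesis by (simp add: sum_list_S_seq)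
qed

lemma interval_start_second_copy: "interval_start (length (S_seq k)) = (k + 1) * 2 ^ k"
  using interval_start_add_block[OF is_block_0, of k] by (simp add: interval_start_def)

section \<open>Volume placed by the mechanism\<close>

text \<open>The cutoff \<open>l\<close> captures the state just before job \<open>l\<close> arrives;
  the bound \<open>x\<close> keeps only jobs small enough for the later exchange argument.\<close>

definition jobs_in ::
  "(nat \<Rightarrow> nat) \<Rightarrow> (nat \<Rightarrow> nat \<times> nat) \<Rightarrow> nat \<Rightarrow> nat \<Rightarrow> nat set \<Rightarrow> nat \<Rightarrow> nat set" where
  "jobs_in p a l x I h = {j \<in> {1..<l}. p j \<le> x \<and> fst (a j) \<in> I \<and> snd (a j) = h}"

lemma finite_jobs_in [simp]: "finite (jobs_in p a l x I h)"
  by (simp add: jobs_in_def)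

lemma alg_run_fits:
  assumes "alg_run m n r p a" "j \<in> {1..n}"
  shows "p j \<le> S_inf (fst (a j))"
proof -
  have "a j \<in> available m r p a j" using assms by (simp add: alg_run_def)
  then show ?thesis by (auto simp: available_def)
qed

text \<open>The greedy rule in contrapositive form: were the pair free, it would be available and
  start strictly before the chosen interval.\<close>

lemma earlier_interval_occupied:
  assumes run: "alg_run m n r p a" and j: "j \<in> {1..n}" and "h < m"
    and "r j \<le> interval_start i" "p j \<le> S_inf i" "i < fst (a j)"
  shows "\<exists>j'\<in>{1..<j}. a j' = (i, h)"
proof (rule ccontr)
  assume "\<not> ?thesis"
  then have "(i, h) \<in> available m r p a j" using assms by (auto simp: available_def)
  then have "interval_start (fst (a j)) \<le> interval_start i"
    using run j by (force simp: alg_run_def)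
  then show False using \<open>i < fst (a j)\<close> strict_mono_interval_start
    by (simp add: strict_mono_less_eq)
qed

text \<open>A job of size \<open>2 ^ i\<close> in the final interval (of length \<open>2 ^ k\<close>, \<open>i < k\<close>) of a block was put
  there because the intervals of length \<open>2 ^ i\<close> in the block were taken; so the volume in
  the block is accounted for by the jobs of size at most \<open>2 ^ i\<close>.\<close>

lemma block_volume:
  assumes run: "alg_run m n r p a" and l: "l \<le> Suc n" and h: "h < m"
    and pow: "\<forall>j\<in>{1..n}. \<exists>k. p j = 2 ^ k"
    and "is_block q b" "k \<le> q" "\<forall>j\<in>{1..<l}. r j \<le> interval_start b"
    and "\<forall>i\<in>{b..<b + length (S_seq q)}. S_inf i = 2 ^ k \<longrightarrow> (\<exists>j\<in>{1..<l}. a j = (i, h))"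
  shows "2 ^ q \<le> sum p (jobs_in p a l (2 ^ k) {b..<b + length (S_seq q)} h)"
  using assms(5-)
proof (induction k arbitrary: q b rule: less_induct)
  case (less k)
  \<comment> \<open>The inner induction on \<open>q\<close> starts at \<open>q = k\<close>, where
    the only interval of length \<open>2 ^ k\<close> is the last one of the block.\<close>
  show ?case
    using less.prems(2,1,3,4)
  proof (induction q arbitrary: b rule: dec_induct)
    case base
    let ?e = "b + length (S_seq k)"
    have len: "0 < length (S_seq k)" using less_length_S_seq[of k] by linarith
    have last: "S_inf (?e - 1) = 2 ^ k" using base.prems(1) by (rule is_block_last)
    have in_block: "?e - 1 \<in> {b..<?e}" using len unfolding atLeastLessThan_iff by linarith
    then obtain j where j: "j \<in> {1..<l}" "a j = (?e - 1, h)" using base.prems(3) last by blast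
    then have jn: "j \<in> {1..n}" using l by auto
    have "p j \<le> 2 ^ k" using alg_run_fits[OF run jn] j last by simp
    then have jin: "j \<in> jobs_in p a l (2 ^ k) {b..<?e} h"
      unfolding jobs_in_def using j in_block by simp
    obtain i where i: "p j = 2 ^ i" using pow jn by blast
    with \<open>p j \<le> 2 ^ k\<close> have "i \<le> k" by simp
    show ?case
    proof (cases "i = k")
      case True
      then show ?thesis using member_le_sum[OF jin, of p] i by simp
    next
      case False
      with \<open>i \<le> k\<close> have "i < k" by simp
      \<comment> \<open>The outer hypothesis is applied to the smaller size exponent
        \<open>i\<close> but to the same block, so the volume obtained is still
        \<open>2 ^ k\<close>.\<close>
      have "2 ^ k \<le> sum p (jobs_in p a l (2 ^ i) {b..<?e} h)"
      proof (rule less.IH[OF \<open>i < k\<close> base.prems(1)])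
        show "i \<le> k" by fact
        show "\<forall>j\<in>{1..<l}. r j \<le> interval_start b" by fact
        show "\<forall>i'\<in>{b..<?e}. S_inf i' = 2 ^ i \<longrightarrow> (\<exists>j\<in>{1..<l}. a j = (i', h))"
        proof (intro ballI impI)
          fix i' assume i': "i' \<in> {b..<?e}" "S_inf i' = 2 ^ i"
          then have "i' \<noteq> ?e - 1" using last \<open>i < k\<close> by auto
          then have "i' < fst (a j)" using i' j by auto
          moreover have "r j \<le> interval_start i'"
          proof -
            have "interval_start b \<le> interval_start i'"
              using i' strict_mono_interval_start by (simp add: strict_mono_less_eq)
            moreover have "r j \<le> interval_start b" using base.prems(2) j by blast
            ultimately show ?thesis by linarith
          qed
          moreover have "p j \<le> S_inf i'" using i i' by simp
          ultimately obtain j' where "j' \<in> {1..<j}" "a j' = (i', h)"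
            using earlier_interval_occupied[OF run jn h, of i'] by blast
          then show "\<exists>j\<in>{1..<l}. a j = (i', h)" using j by auto
        qed
      qed
      also have "\<dots> \<le> sum p (jobs_in p a l (2 ^ k) {b..<?e} h)"
      proof (rule sum_mono2)
        have "(2::nat) ^ i \<le> 2 ^ k" using \<open>i \<le> k\<close> by simp
        then show "jobs_in p a l (2 ^ i) {b..<?e} h \<subseteq> jobs_in p a l (2 ^ k) {b..<?e} h"
          by (auto simp: jobs_in_def simp del: power_increasing_iff)
      qed auto
      finally show ?thesis .
    qed
  next
    case (step q)
    let ?c = "b + length (S_seq q)" and ?J = "\<lambda>I. jobs_in p a l (2 ^ k) I h"
    have bl: "is_block q b" "is_block q ?c" using is_block_Suc[OF step.prems(1)] by auto
    have "interval_start b \<le> interval_start ?c"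
      using strict_mono_interval_start by (simp add: strict_mono_less_eq)
    then have r: "\<forall>j\<in>{1..<l}. r j \<le> interval_start ?c"
      using step.prems(2) by (meson of_nat_mono order_trans)
    \<comment> \<open>The two copies of \<open>S_seq q\<close> already supply
      \<open>2 ^ Suc q\<close>; the final long interval is ignored.\<close>
    have "2 ^ q + 2 ^ q \<le> sum p (?J {b..<?c}) + sum p (?J {?c..<?c + length (S_seq q)})"
    proof (rule add_mono)
      show "2 ^ q \<le> sum p (?J {b..<?c})"
        by (rule step.IH[OF bl(1) step.prems(2)]) (use step.prems(3) in auto)
      show "2 ^ q \<le> sum p (?J {?c..<?c + length (S_seq q)})"
        by (rule step.IH[OF bl(2) r]) (use step.prems(3) in auto)
    qed
    also have "\<dots> = sum p (?J {b..<?c} \<union> ?J {?c..<?c + length (S_seq q)})"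
      by (rule sum.union_disjoint[symmetric]) (auto simp: jobs_in_def)
    also have "\<dots> \<le> sum p (?J {b..<b + length (S_seq (Suc q))})"
      by (rule sum_mono2) (auto simp: jobs_in_def)
    finally show ?case by simp
  qed
qed

lemma alg_completion_le_interval_start:
  assumes "alg_run m n r p a" "j \<in> {1..n}" "fst (a j) < e"
  shows "alg_completion p a j \<le> interval_start e"
proof -
  have "interval_start (fst (a j)) + p j \<le> interval_start (Suc (fst (a j)))"
    using alg_run_fits[OF assms(1,2)] by (simp add: interval_start_Suc)
  also have "\<dots> \<le> interval_start e"
    using assms(3) strict_mono_interval_start by (simp add: strict_mono_less_eq)
  finally show ?thesis by (simp add: alg_completion_def flip: of_nat_add)
qed

text \<open>At the arrival of \<open>j\<close>, every interval of length \<open>p j\<close> in the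
  block was taken on every machine. So \<open>block_volume\<close> with \<open>l = j\<close> applies
  to each machine, and the bounds add up over the disjoint sets of jobs.\<close>

lemma late_job_volume:
  assumes run: "alg_run m n r p a" and inst: "valid_instance n r p"
    and j: "j \<in> {1..n}" "r j \<le> interval_start b"
    and block: "is_block q b" "p j \<le> 2 ^ q"
    and late: "\<not> alg_completion p a j \<le> interval_start (b + length (S_seq q))"
  shows "m * 2 ^ q \<le> sum p {j' \<in> {1..n}. p j' \<le> p j \<and>
           alg_completion p a j' \<le> interval_start (b + length (S_seq q))}"
proof -
  let ?e = "b + length (S_seq q)"
  let ?J = "jobs_in p a j (p j) {b..<?e}"
  have pow: "\<forall>j\<in>{1..n}. \<exists>k. p j = 2 ^ k" using inst by (simp add: valid_instance_def)
  then obtain k where k: "p j = 2 ^ k" using j by blast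
  have kq: "k \<le> q" using block(2) k by simp
  \<comment> \<open>A job placed before the end of the block would also complete by then.\<close>
  have fst: "?e \<le> fst (a j)"
    using alg_completion_le_interval_start[OF run j(1), of ?e] late by linarith
  have r: "\<forall>j'\<in>{1..<j}. r j' \<le> interval_start b"
  proof
    fix j' assume "j' \<in> {1..<j}"
    then have "r j' \<le> r j" using inst j(1) by (simp add: valid_instance_def)
    then show "r j' \<le> interval_start b" using j(2) by linarith
  qed
  have "2 ^ q \<le> sum p (?J h)" if h: "h < m" for h
    unfolding k
  proof (rule block_volume[OF run _ h pow block(1) kq r])
    show "\<forall>i\<in>{b..<?e}. S_inf i = 2 ^ k \<longrightarrow> (\<exists>j'\<in>{1..<j}. a j' = (i, h))"
    proof (intro ballI impI)
      fix i assume i: "i \<in> {b..<?e}" "S_inf i = 2 ^ k"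
      have "interval_start b \<le> interval_start i"
        using i strict_mono_interval_start by (simp add: strict_mono_less_eq)
      then show "\<exists>j'\<in>{1..<j}. a j' = (i, h)"
        using earlier_interval_occupied[OF run j(1) h, of i] j(2) i k fst by simp
    qed
  qed (use j in auto)
  then have "(\<Sum>h<m. 2 ^ q) \<le> (\<Sum>h<m. sum p (?J h))" by (intro sum_mono) auto
  then have "m * 2 ^ q \<le> (\<Sum>h<m. sum p (?J h))" by simp
  also have "\<dots> = sum p (\<Union>h<m. ?J h)"
    by (rule sum.UNION_disjoint[symmetric]) (auto simp: jobs_in_def)
  also have "\<dots> \<le> sum p {j' \<in> {1..n}. p j' \<le> p j \<and> alg_completion p a j' \<le> interval_start ?e}"
    using j alg_completion_le_interval_start[OF run, of _ ?e]
    by (intro sum_mono2) (auto simp: jobs_in_def)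
  finally show ?thesis .
qed

section \<open>Preemptive schedules\<close>

lemma feasibleD:
  assumes "feasible m n r p \<sigma>" "j \<in> {1..n}"
  shows "h < m \<Longrightarrow> {t. \<sigma> h t = Some j} \<in> sets lebesgue"
    and "h < m \<Longrightarrow> \<sigma> h t = Some j \<Longrightarrow> r j \<le> t"
    and "{t. 0 \<le> t \<and> real (p j) \<le> processed m \<sigma> j t} \<noteq> {}"
proof -
  note * = bspec[OF assms(1)[unfolded feasible_def] assms(2)]
  show "h < m \<Longrightarrow> {t. \<sigma> h t = Some j} \<in> sets lebesgue"
    and "h < m \<Longrightarrow> \<sigma> h t = Some j \<Longrightarrow> r j \<le> t"
    and "{t. 0 \<le> t \<and> real (p j) \<le> processed m \<sigma> j t} \<noteq> {}"
    using * by blast+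
qed

lemma lmeasurable_processed:
  assumes "feasible m n r p \<sigma>" "j \<in> {1..n}"
  shows "{s \<in> {0..t}. \<exists>h<m. \<sigma> h s = Some j} \<in> lmeasurable"
proof -
  have "(\<Union>h<m. {s. \<sigma> h s = Some j}) \<in> sets lebesgue"
    by (rule sets.finite_UN) (simp_all add: feasibleD(1)[OF assms])
  then have "{0..t} \<inter> (\<Union>h<m. {s. \<sigma> h s = Some j}) \<in> lmeasurable"
    by (intro fmeasurable_Int_fmeasurable) simp_all
  also have "{0..t} \<inter> (\<Union>h<m. {s. \<sigma> h s = Some j}) = {s \<in> {0..t}. \<exists>h<m. \<sigma> h s = Some j}"
    by blast
  finally show ?thesis .
qed

lemma processed_mono:
  assumes "feasible m n r p \<sigma>" "j \<in> {1..n}" and "t \<le> u"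
  shows "processed m \<sigma> j t \<le> processed m \<sigma> j u"
  unfolding processed_def
proof (rule measure_mono_fmeasurable)
  show "{s \<in> {0..t}. \<exists>h<m. \<sigma> h s = Some j} \<subseteq> {s \<in> {0..u}. \<exists>h<m. \<sigma> h s = Some j}"
    using \<open>t \<le> u\<close> by force
  show "{s \<in> {0..t}. \<exists>h<m. \<sigma> h s = Some j} \<in> sets lebesgue"
    by (rule fmeasurableD[OF lmeasurable_processed[OF assms(1,2)]])
qed (rule lmeasurable_processed[OF assms(1,2)])

lemma valid_instanceD:
  assumes "valid_instance n r p" "j \<in> {1..n}"
  shows "0 \<le> r j" "1 \<le> p j"
proof -
  obtain k where "p j = 2 ^ k" using assms unfolding valid_instance_def by blast
  then show "1 \<le> p j" by simp
  show "0 \<le> r j" using assms by (simp add: valid_instance_def)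
qed

text \<open>\<open>processed\<close> measures a set of times, all of them at least
  \<open>r j\<close>, so a job progresses at rate at most one after its release.\<close>

lemma completion_ge:
  assumes feas: "feasible m n r p \<sigma>" and j: "j \<in> {1..n}" and "1 \<le> p j" "0 \<le> r j"
  shows "r j + p j \<le> completion m p \<sigma> j"
  unfolding completion_def
proof (rule cInf_greatest)
  show "{t. 0 \<le> t \<and> real (p j) \<le> processed m \<sigma> j t} \<noteq> {}"
    by (rule feasibleD(3)[OF feas j])
next
  fix t assume t: "t \<in> {t. 0 \<le> t \<and> real (p j) \<le> processed m \<sigma> j t}"
  have sub: "{s \<in> {0..t}. \<exists>h<m. \<sigma> h s = Some j} \<subseteq> {r j..t}"
    using feasibleD(2)[OF feas j] by fastforce
  have "processed m \<sigma> j t \<le> measure lebesgue {r j..t}"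
    unfolding processed_def
    by (rule measure_mono_fmeasurable[OF sub fmeasurableD[OF lmeasurable_processed[OF feas j]]]) simp
  then have "real (p j) \<le> measure lebesgue {r j..t}" using t by simp
  then show "r j + p j \<le> t" using \<open>1 \<le> p j\<close> by (cases "r j \<le> t") auto
qed

text \<open>A machine runs at most one job at a time, so for fixed \<open>h\<close> the sets
  \<open>A h j\<close> are disjoint subsets of \<open>{0..t}\<close>.\<close>

lemma processed_total:
  assumes feas: "feasible m n r p \<sigma>" and N: "N \<subseteq> {1..n}" and t: "0 \<le> t"
  shows "(\<Sum>j\<in>N. processed m \<sigma> j t) \<le> m * t"
proof -
  define A where "A h j = {s. \<sigma> h s = Some j} \<inter> {0..t}" for h j
  have finN: "finite N" using N finite_subset by blast
  have A: "A h j \<in> lmeasurable" if "h < m" "j \<in> N" for h j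
  proof -
    have "{s. \<sigma> h s = Some j} \<in> sets lebesgue"
      by (rule feasibleD(1)[OF feas _ that(1)]) (use N that(2) in blast)
    then show ?thesis unfolding A_def by (simp add: fmeasurable_Int_fmeasurable Int_commute)
  qed
  have "(\<Sum>j\<in>N. processed m \<sigma> j t) \<le> (\<Sum>j\<in>N. \<Sum>h<m. measure lebesgue (A h j))"
  proof (rule sum_mono)
    fix j assume "j \<in> N"
    have "{s \<in> {0..t}. \<exists>h<m. \<sigma> h s = Some j} = (\<Union>h<m. A h j)" by (auto simp: A_def)
    then show "processed m \<sigma> j t \<le> (\<Sum>h<m. measure lebesgue (A h j))"
      unfolding processed_def using A \<open>j \<in> N\<close> by (auto intro!: measure_UNION_le)
  qed
  also have "\<dots> = (\<Sum>h<m. \<Sum>j\<in>N. measure lebesgue (A h j))" by (rule sum.swap)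
  also have "\<dots> \<le> (\<Sum>h<m. t)"
  proof (rule sum_mono)
    fix h assume "h \<in> {..<m}"
    then have "(\<Sum>j\<in>N. measure lebesgue (A h j)) = measure lebesgue (\<Union>j\<in>N. A h j)"
      using A finN by (intro measure_UNION'[symmetric])
        (auto simp: A_def pairwise_def disjnt_def)
    also have "\<dots> \<le> measure lebesgue {0..t}"
    proof (rule measure_mono_fmeasurable)
      show "(\<Union>j\<in>N. A h j) \<in> sets lebesgue"
        using A finN \<open>h \<in> {..<m}\<close> by (intro sets.finite_UN) auto
    qed (auto simp: A_def)
    finally show "(\<Sum>j\<in>N. measure lebesgue (A h j)) \<le> t" using t by simp
  qed
  finally show ?thesis by simp
qed

lemma completed_volume:
  assumes feas: "feasible m n r p \<sigma>" and t: "0 \<le> t"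
  shows "(\<Sum>j | j \<in> {1..n} \<and> completion m p \<sigma> j \<le> t. real (p j)) \<le> m * t"
    (is "sum _ ?N \<le> _")
proof (rule field_le_epsilon)
  fix e :: real assume "0 < e"
  \<comment> \<open>The completion time is an infimum, so the work is measured slightly later, at
    \<open>t + d\<close>; the denominator \<open>m + 1\<close> ensures
    \<open>m * d <= e\<close>.\<close>
  define d where "d = e / (m + 1)"
  have d: "0 < d" using \<open>0 < e\<close> by (simp add: d_def)
  have "real (p j) \<le> processed m \<sigma> j (t + d)" if "j \<in> ?N" for j
  proof -
    let ?X = "{u. 0 \<le> u \<and> real (p j) \<le> processed m \<sigma> j u}"
    have "?X \<noteq> {}" using feasibleD(3)[OF feas] that by blast
    moreover have "Inf ?X < t + d" using that d by (simp add: completion_def)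
    ultimately obtain u where u: "u \<in> ?X" "u < t + d" by (rule cInf_lessD[THEN bexE])
    have "processed m \<sigma> j u \<le> processed m \<sigma> j (t + d)"
      by (rule processed_mono[OF feas]) (use that u(2) in simp_all)
    then show ?thesis using u(1) by simp
  qed
  then have "(\<Sum>j\<in>?N. real (p j)) \<le> (\<Sum>j\<in>?N. processed m \<sigma> j (t + d))"
    by (rule sum_mono)
  also have "\<dots> \<le> m * (t + d)"
    by (rule processed_total[OF feas]) (use t d in auto)
  also have "\<dots> \<le> m * t + e" using \<open>0 < e\<close> by (simp add: d_def field_simps)
  finally show "(\<Sum>j\<in>?N. real (p j)) \<le> m * t + e" .
qed

text \<open>Machine 0 runs the jobs one after another in slots of length \<open>P\<close>, all after
  \<open>X\<close>, which bounds every release time. This makes the set in \<open>OPT\<close>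
  nonempty.\<close>

lemma feasible_exists:
  assumes "1 \<le> m" and "valid_instance n r p"
  shows "\<exists>\<sigma>. feasible m n r p \<sigma>"
proof -
  define P where "P = 1 + (\<Sum>j=1..n. real (p j))"
  define X where "X = (\<Sum>j=1..n. r j)"
  \<comment> \<open>Since \<open>nat\<close> sends negative numbers to 0, all times before
    \<open>X + P\<close> get index 0, which is not a job.\<close>
  define \<sigma> :: schedule where "\<sigma> h t = (if h = 0 then Some (nat \<lfloor>(t - X) / P\<rfloor>) else None)" for h t
  have r0: "\<forall>j\<in>{1..n}. 0 \<le> r j" using assms(2) by (simp add: valid_instance_def)
  have P: "P > 0" "real (p j) \<le> P" if "j \<in> {1..n}" for j
  proof -
    have "0 \<le> (\<Sum>j=1..n. real (p j))" by (rule sum_nonneg) simp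
    then show "P > 0" by (simp add: P_def)
    have "real (p j) \<le> (\<Sum>j=1..n. real (p j))" using that by (intro member_le_sum) auto
    then show "real (p j) \<le> P" by (simp add: P_def)
  qed
  have X: "r j \<le> X" "0 \<le> X" if "j \<in> {1..n}" for j
  proof -
    show "r j \<le> X" unfolding X_def using that r0 by (intro member_le_sum) auto
    moreover have "0 \<le> r j" using r0 that by blast
    ultimately show "0 \<le> X" by linarith
  qed
  have run: "{t. \<sigma> 0 t = Some j} = {X + j * P..<X + (j + 1) * P}" if j: "j \<in> {1..n}" for j
  proof -
    have "nat \<lfloor>y\<rfloor> = j \<longleftrightarrow> real j \<le> y \<and> y < real j + 1" for y
      using j by (simp add: nat_eq_iff floor_eq_iff)
    moreover have "real j \<le> (t - X) / P \<longleftrightarrow> X + j * P \<le> t"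
      "(t - X) / P < real j + 1 \<longleftrightarrow> t < X + (j + 1) * P" for t
      using P(1)[OF j] by (auto simp: pos_le_divide_eq pos_divide_less_eq algebra_simps)
    ultimately show ?thesis by (auto simp: \<sigma>_def add.commute)
  qed
  have "feasible m n r p \<sigma>"
    unfolding feasible_def
  proof (intro ballI conjI allI impI)
    fix j assume j: "j \<in> {1..n}"
    show "{t. \<sigma> h t = Some j} \<in> sets lebesgue" for h
    proof (cases "h = 0")
      case True
      then show ?thesis by (simp add: run[OF j])
    qed (simp add: \<sigma>_def)
    show "r j \<le> t" if "\<sigma> h t = Some j" for h t
    proof -
      have "t \<in> {t. \<sigma> 0 t = Some j}" using that by (simp add: \<sigma>_def split: if_splits)
      then have "X + j * P \<le> t" unfolding run[OF j] by simp
      moreover have "0 \<le> j * P" using P(1)[OF j] by simp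
      ultimately show ?thesis using X(1)[OF j] by linarith
    qed
    show "h = h'" if "\<sigma> h t = Some j \<and> \<sigma> h' t = Some j" for h h' t
      using that by (simp add: \<sigma>_def split: if_splits)
    let ?t = "X + (j + 1) * P"
    have nn: "0 \<le> X + j * P" "?t = X + j * P + P"
      using X(2)[OF j] P(1)[OF j] by (simp_all add: algebra_simps)
    have "{s \<in> {0..?t}. \<exists>h<m. \<sigma> h s = Some j} = {s. \<sigma> 0 s = Some j} \<inter> {0..?t}"
    proof -
      have "(\<exists>h<m. \<sigma> h s = Some j) \<longleftrightarrow> \<sigma> 0 s = Some j" for s
      proof
        assume "\<exists>h<m. \<sigma> h s = Some j"
        then obtain h where "\<sigma> h s = Some j" by blast
        then show "\<sigma> 0 s = Some j" by (simp add: \<sigma>_def split: if_splits)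
      qed (use \<open>1 \<le> m\<close> in \<open>auto intro!: exI[of _ 0]\<close>)
      then show ?thesis by blast
    qed
    also have "\<dots> = {X + j * P..<?t}" unfolding run[OF j] using nn(1) by (auto simp: add.commute)
    finally have "processed m \<sigma> j ?t = P"
      unfolding processed_def nn(2) using P(1)[OF j] by simp
    moreover have "0 \<le> ?t" unfolding nn(2) using nn(1) P(1)[OF j] by linarith
    ultimately show "\<exists>t\<ge>0. real (p j) \<le> processed m \<sigma> j t"
      using P(2)[OF j] by (intro exI[of _ ?t]) simp
  qed
  then show ?thesis by blast
qed

section \<open>Comparing completion counts\<close>

text \<open>The count condition says that the \<open>k\<close>-th smallest value of \<open>f\<close>
  is at most that of \<open>g\<close>. The induction pairs off the two maxima.\<close>

lemma sum_le_sum_if_counts_le: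
  fixes f :: "'a \<Rightarrow> real" and g :: "'b \<Rightarrow> real"
  assumes "finite A" "finite B" "card A = card B"
    and "\<And>t. card {y \<in> B. g y \<le> t} \<le> card {x \<in> A. f x \<le> t}"
  shows "sum f A \<le> sum g B"
  using assms
proof (induction "card A" arbitrary: A B)
  case 0
  then show ?case by simp
next
  case (Suc k)
  have ne: "A \<noteq> {}" "B \<noteq> {}" using Suc by auto
  obtain x where x: "x \<in> A" "\<forall>x'\<in>A. f x' \<le> f x"
  proof -
    have "Max (f ` A) \<in> f ` A" using Suc.prems ne by (intro Max_in) auto
    then obtain x where "x \<in> A" "f x = Max (f ` A)" by auto
    then show thesis using that Suc.prems by auto
  qed
  obtain y where y: "y \<in> B" "\<forall>y'\<in>B. g y' \<le> g y"
  proof -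
    have "Max (g ` B) \<in> g ` B" using Suc.prems ne by (intro Max_in) auto
    then obtain y where "y \<in> B" "g y = Max (g ` B)" by auto
    then show thesis using that Suc.prems by auto
  qed
  have "{y' \<in> B. g y' \<le> g y} = B" using y by auto
  then have "card A \<le> card {x' \<in> A. f x' \<le> g y}" using Suc.prems(3) Suc.prems(4)[of "g y"] by simp
  then have "{x' \<in> A. f x' \<le> g y} = A" using Suc.prems(1) by (intro card_seteq) auto
  then have fg: "f x \<le> g y" using x(1) by blast
  have "sum f (A - {x}) \<le> sum g (B - {y})"
  proof (rule Suc.hyps(1))
    show "card {y' \<in> B - {y}. g y' \<le> t} \<le> card {x' \<in> A - {x}. f x' \<le> t}" for t
    \<comment> \<open>For \<open>t\<close> at least the maximum \<open>f x\<close>, all of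
      \<open>A - {x}\<close> is counted; below it, neither removed element was counted.\<close>
    proof (cases "f x \<le> t")
      case True
      then have "{x' \<in> A - {x}. f x' \<le> t} = A - {x}" using x by force
      moreover have "card {y' \<in> B - {y}. g y' \<le> t} \<le> card (B - {y})"
        using Suc.prems(2) by (intro card_mono) auto
      ultimately show ?thesis using Suc.prems x y by simp
    next
      case False
      then have "{x' \<in> A - {x}. f x' \<le> t} = {x' \<in> A. f x' \<le> t}"
        "{y' \<in> B - {y}. g y' \<le> t} = {y' \<in> B. g y' \<le> t}" using fg by auto
      then show ?thesis using Suc.prems(4) by simp
    qed
  qed (use Suc x y in auto)
  then show ?case
    using fg Suc.prems(1,2) x y by (simp add: sum.remove[of A x] sum.remove[of B y])
qed

text \<open>After cancelling the common elements, \<open>N - D\<close> has no more volume than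
  \<open>D - N\<close>, while its elements have size at least \<open>x\<close> and those of
  \<open>D - N\<close> at most \<open>x\<close>.\<close>

lemma card_le_if_volume_le:
  fixes p :: "'a \<Rightarrow> nat"
  assumes fin: "finite N" "finite D" and vol: "sum p N \<le> sum p D" and "0 < x"
    and D: "\<forall>j\<in>D. p j \<le> x" and N: "\<forall>j\<in>N - D. x \<le> p j"
  shows "card N \<le> card D"
proof -
  have "sum p (N - D) \<le> sum p (D - N)"
    using vol sum.Int_Diff[OF fin(1), of p D] sum.Int_Diff[OF fin(2), of p N]
    by (simp add: Int_commute)
  moreover have "card (N - D) * x \<le> sum p (N - D)"
    using N sum_bounded_below[of "N - D" x p] by simp
  moreover have "sum p (D - N) \<le> card (D - N) * x"
    using D sum_bounded_above[of "D - N" p x] by simp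
  ultimately have "card (N - D) * x \<le> card (D - N) * x" by linarith
  then have "card (N - D) \<le> card (D - N)" using \<open>0 < x\<close> by simp
  then show ?thesis
    using card_Int_Diff[OF fin(1), of D] card_Int_Diff[OF fin(2), of N]
    by (simp add: Int_commute)
qed

section \<open>The mechanism against an arbitrary schedule\<close>

lemma alg_completes_all_at_late_times:
  assumes m: "1 \<le> m" and run: "alg_run m n r p a" and inst: "valid_instance n r p"
    and small: "(\<Sum>j=1..n. p j) < 2 ^ K" and t: "real ((K + 1) * 2 ^ K) \<le> t"
    and j: "j \<in> {1..n}" "r j \<le> t"
  shows "alg_completion p a j \<le> 5 * t"
proof -
  let ?L = "\<lambda>k::nat. (k + 1) * 2 ^ k :: nat"
  \<comment> \<open>\<open>?L q\<close> is the start of the second copy of \<open>S_seq q\<close>,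
    so this copy is the first of its kind to start after \<open>t\<close>.\<close>
  define q where "q = (LEAST q. t < real (?L q))"
  obtain u :: nat where "t < real u" using reals_Archimedean2 by blast
  also have "real u \<le> real (?L u)"
    using less_exp[of u] by (intro of_nat_mono) (simp add: trans_le_add1)
  finally have q: "t < real (?L q)" unfolding q_def by (rule LeastI)
  have monoL: "?L k \<le> ?L l" if "k \<le> l" for k l
    using that by (intro mult_mono power_increasing) auto
  have "K < q"
  proof (rule ccontr)
    assume "\<not> K < q"
    then have "real (?L q) \<le> real (?L K)" by (intro of_nat_mono monoL) simp
    then show False using t q by linarith
  qed
  then obtain q' where q': "q = Suc q'" "K \<le> q'" by (cases q) auto
  have "\<not> t < real (?L q')"
    using not_less_Least[of q' "\<lambda>q. t < real (?L q)"] q' by (simp add: q_def)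
  then have low: "real (?L q') \<le> t" by linarith
  let ?b = "length (S_seq q)"
  have start: "interval_start ?b = ?L q" by (rule interval_start_second_copy)
  have block: "is_block K ?b"
    using is_block_antimono[OF _ is_block_second_copy] \<open>K < q\<close> by auto
  have "p j \<le> (\<Sum>j=1..n. p j)" using j by (intro member_le_sum) auto
  then have pj: "p j \<le> 2 ^ K" using small by linarith
  have "alg_completion p a j \<le> interval_start (?b + length (S_seq K))"
  proof (rule ccontr)
    assume late: "\<not> ?thesis"
    have "r j \<le> real (interval_start ?b)" using q j start by simp
    from late_job_volume[OF run inst j(1) this block pj late]
    have "m * 2 ^ K \<le> (\<Sum>j=1..n. p j)" by (rule order_trans) (intro sum_mono2, auto)
    moreover have "2 ^ K \<le> m * 2 ^ K" using m by simp
    ultimately show False using small by linarith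
  qed
  also have "\<dots> = real (?L q) + real (?L K)"
    unfolding interval_start_add_block[OF block] start by simp
  \<comment> \<open>Passing from \<open>q'\<close> to \<open>q\<close> at most quadruples the start,
    so the block starts by \<open>4 * t\<close>; its own length \<open>?L K\<close> is at most
    \<open>t\<close>.\<close>
  also have "real (?L q) \<le> 4 * real (?L q')" by (simp add: q'(1) algebra_simps)
  finally show ?thesis using low t by linarith
qed

lemma alg_count_ge_opt_count:
  assumes m: "1 \<le> m" and run: "alg_run m n r p a" and inst: "valid_instance n r p"
    and feas: "feasible m n r p \<sigma>" and K: "1 \<le> K" "(\<Sum>j=1..n. p j) < 2 ^ K"
  shows "card {j \<in> {1..n}. completion m p \<sigma> j \<le> t}
           \<le> card {j \<in> {1..n}. alg_completion p a j \<le> 4 * (2 * real K + 1) * t}"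
    (is "card ?N \<le> card ?D")
proof -
  note p1 = valid_instanceD(2)[OF inst] and r0 = valid_instanceD(1)[OF inst]
  have opt: "r j + p j \<le> t" if "j \<in> ?N" for j
    using completion_ge[OF feas, of j] p1[of j] r0[of j] that by simp
  show ?thesis
  proof (cases "?N \<subseteq> ?D")
    case True
    then show ?thesis by (intro card_mono) auto
  next
    case False
    then obtain j0 where j0: "j0 \<in> ?N" "j0 \<notin> ?D" by blast
    then have j0_ge: "r j0 + p j0 \<le> t" "1 \<le> p j0" "0 \<le> r j0" using opt p1 r0 by blast+
    then have t1: "1 \<le> t" by linarith
    define U where "U = {j \<in> {1..n}. r j \<le> t} - ?D"
    have "j0 \<in> U" unfolding U_def using j0 j0_ge by simp
    then obtain j where "j \<in> U" and j_min: "\<forall>j'. j' \<in> U \<longrightarrow> p j \<le> p j'"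
      using ex_has_least_nat[of "\<lambda>j. j \<in> U" j0 p] by blast
    have j: "j \<in> {1..n}" "r j \<le> t"
      and j_late: "\<not> alg_completion p a j \<le> 4 * (2 * real K + 1) * t"
      using \<open>j \<in> U\<close> unfolding U_def by simp_all
    have large: "p j \<le> p j'" if "j' \<in> ?N - ?D" for j'
    proof -
      have "r j' \<le> t" using opt[of j'] that by simp
      then have "j' \<in> U" unfolding U_def using that by blast
      then show ?thesis using j_min by blast
    qed
    have "real (p j) \<le> real (p j0)" using large j0 by simp
    also have "\<dots> \<le> t" using j0_ge by linarith
    finally have pt: "real (p j) \<le> t" .
    have early: "t < real ((K + 1) * 2 ^ K)"
    proof (rule ccontr)
      assume "\<not> ?thesis"
      then have "alg_completion p a j \<le> 5 * t"
        by (intro alg_completes_all_at_late_times[OF m run inst K(2) _ j]) (simp add: not_less)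
      \<comment> \<open>As \<open>K >= 1\<close>, the factor is at least 12, which covers the
        5.\<close>
      also have "\<dots> \<le> 4 * (2 * real K + 1) * t" using t1 K(1) by (intro mult_right_mono) auto
      finally show False using j_late by blast
    qed
    define q where "q = (LEAST q. t \<le> 2 ^ q)"
    have "t \<le> 2 ^ (2 * K)"
    proof -
      have "(K + 1) * 2 ^ K \<le> 2 ^ K * (2 ^ K :: nat)"
        using less_exp[of K] by (intro mult_right_mono) (simp_all add: Suc_le_eq)
      then have "real ((K + 1) * 2 ^ K) \<le> real (2 ^ K * 2 ^ K)" by (rule of_nat_mono)
      also have "\<dots> = 2 ^ (2 * K)" by (simp add: mult_2 power_add)
      finally show ?thesis using early by linarith
    qed
    then have tq: "t \<le> 2 ^ q" and qK: "q \<le> 2 * K"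
      unfolding q_def by (rule LeastI, rule Least_le)
    \<comment> \<open>Rounding up at most doubles \<open>t\<close>; for \<open>q = 0\<close> this
      uses \<open>1 <= t\<close>.\<close>
    have q2: "2 ^ q \<le> 2 * t"
    proof (cases q)
      case (Suc q')
      then have "\<not> t \<le> 2 ^ q'" using not_less_Least[of q' "\<lambda>q. t \<le> 2 ^ q"] by (simp add: q_def)
      then show ?thesis using Suc by simp
    qed (use t1 in auto)
    let ?b = "length (S_seq q)"
    have block: "is_block q ?b" by (rule is_block_second_copy)
    have ends: "interval_start (?b + length (S_seq q)) \<le> 4 * (2 * real K + 1) * t"
    proof -
      have "real (interval_start (?b + length (S_seq q))) = real (q + 1) * (2 * 2 ^ q)"
        unfolding interval_start_add_block[OF block] interval_start_second_copy
        by (simp add: algebra_simps)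
      \<comment> \<open>The two copies of \<open>S_seq q\<close> last
        \<open>2 * (q + 1) * 2 ^ q\<close> together; \<open>q <= 2 * K\<close> and
        \<open>2 ^ q <= 2 * t\<close> give the stretch factor of the lemma.\<close>
      also have "\<dots> \<le> real (2 * K + 1) * (2 * (2 * t))"
        using qK q2 t1 by (intro mult_mono) auto
      finally show ?thesis by (simp add: algebra_simps)
    qed
    let ?D' = "{j' \<in> ?D. p j' \<le> p j}"
    have "real m * t \<le> real (sum p ?D')"
    proof -
      have "(2::real) ^ q \<le> real (interval_start ?b)" by (simp add: interval_start_second_copy)
      then have rj: "r j \<le> real (interval_start ?b)" using j(2) tq by linarith
      have "real (p j) \<le> 2 ^ q" using pt tq by linarith
      then have pj: "p j \<le> 2 ^ q" by (simp only: of_nat_le_numeral_power_cancel_iff)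
      have late: "\<not> alg_completion p a j \<le> interval_start (?b + length (S_seq q))"
        using j_late ends by linarith
      have "m * 2 ^ q \<le> sum p {j' \<in> {1..n}. p j' \<le> p j \<and>
          alg_completion p a j' \<le> interval_start (?b + length (S_seq q))}"
        by (rule late_job_volume[OF run inst j(1) rj block pj late])
      also have "\<dots> \<le> sum p ?D'" using ends by (intro sum_mono2) auto
      finally have "real (m * 2 ^ q) \<le> real (sum p ?D')" by (rule of_nat_mono)
      moreover have "real m * t \<le> real m * 2 ^ q" using tq by (intro mult_left_mono) auto
      ultimately show ?thesis by simp
    qed
    moreover have "real (sum p ?N) \<le> real m * t"
      using completed_volume[OF feas, of t] t1 by simp
    ultimately have "sum p ?N \<le> sum p ?D'" by linarith
    then have "card ?N \<le> card ?D'"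
    proof (rule card_le_if_volume_le[where x = "p j", rotated 2])
      \<comment> \<open>A job of \<open>?N\<close> outside \<open>?D'\<close> is either late, and
        then no smaller than \<open>j\<close> by minimality, or larger than \<open>j\<close> by the
        definition of \<open>?D'\<close>.\<close>
      show "\<forall>j'\<in>?N - ?D'. p j \<le> p j'"
      proof
        fix j' assume "j' \<in> ?N - ?D'"
        then have "j' \<in> ?N - ?D \<or> \<not> p j' \<le> p j" by blast
        then show "p j \<le> p j'" using large[of j'] by linarith
      qed
    qed (use p1[OF j(1)] in auto)
    also have "\<dots> \<le> card ?D" by (intro card_mono) auto
    finally show ?thesis .
  qed
qed

section \<open>Total processing time in terms of \<open>P_max\<close> and
  \<open>n_max\<close>\<close>

text \<open>With \<open>P_max = 2 ^ q\<close> there are \<open>q + 1 <= 2 ^ q\<close> size classes,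
  so \<open>n <= 2 ^ q * n_max\<close> and the total size is at most
  \<open>2 ^ (2 * q) * n_max\<close>.\<close>

lemma total_size_bound:
  assumes n: "1 \<le> n" and inst: "valid_instance n r p"
  obtains K where "1 \<le> K" "(\<Sum>j=1..n. p j) < 2 ^ K"
    "real K \<le> 4 * max 1 (log 2 (P_max n p) + log 2 (n_max n p))"
proof -
  have pow: "\<exists>k. p j = 2 ^ k" if "j \<in> {1..n}" for j
    using inst that by (simp add: valid_instance_def)
  have "P_max n p \<in> p ` {1..n}" unfolding P_max_def using n by (intro Max_in) auto
  then obtain j where "j \<in> {1..n}" "P_max n p = p j" by blast
  then obtain q where q: "P_max n p = 2 ^ q" using pow by metis
  have pq: "p j \<le> 2 ^ q" if "j \<in> {1..n}" for j
    using that unfolding q[symmetric] P_max_def by (intro Max_ge) auto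
  have logP: "log 2 (real (P_max n p)) = q" by (simp add: q)
  have classes: "{i. real i \<le> log 2 (real (P_max n p))} = {..q}" unfolding logP by auto
  have "n \<le> (\<Sum>i\<le>q. class_size n p i)"
  proof -
    have "j \<in> (\<Union>i\<le>q. {j \<in> {1..n}. 2 ^ i \<le> p j \<and> p j < 2 ^ (i + 1)})"
      if j: "j \<in> {1..n}" for j
    proof -
      obtain k where k: "p j = 2 ^ k" using pow j by blast
      then have "k \<le> q" using pq[OF j] by simp
      then show ?thesis using j k by auto
    qed
    then have "card {1..n} \<le> card (\<Union>i\<le>q. {j \<in> {1..n}. 2 ^ i \<le> p j \<and> p j < 2 ^ (i + 1)})"
      by (intro card_mono) auto
    also have "\<dots> \<le> (\<Sum>i\<le>q. class_size n p i)"
      unfolding class_size_def by (rule card_UN_le) simp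
    finally show ?thesis by simp
  qed
  also have "\<dots> \<le> (q + 1) * n_max n p"
    using sum_bounded_above[of "{..q}" "class_size n p" "n_max n p"]
    by (simp add: n_max_def classes)
  finally have nq: "n \<le> (q + 1) * n_max n p" .
  then have nm: "1 \<le> n_max n p" using n by (cases "n_max n p") auto
  define b where "b = nat \<lceil>log 2 (n_max n p)\<rceil>"
  have log0: "0 \<le> log 2 (n_max n p)" using nm by simp
  have b: "log 2 (n_max n p) \<le> b" "b \<le> log 2 (n_max n p) + 1"
    unfolding b_def using log0 by linarith+
  have "real (n_max n p) = 2 powr log 2 (n_max n p)" using nm by simp
  also have "\<dots> \<le> 2 powr b" using b(1) by (intro powr_mono) auto
  also have "\<dots> = real (2 ^ b)" by (simp add: powr_realpow)
  finally have nb: "n_max n p \<le> 2 ^ b" by (simp only: of_nat_le_iff)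
  show thesis
  proof
    have "(\<Sum>j=1..n. p j) \<le> n * 2 ^ q"
      using sum_bounded_above[of "{1..n}" p "2 ^ q"] pq by simp
    also have "n \<le> 2 ^ q * 2 ^ b"
      using less_exp[of q] by (intro order_trans[OF nq] mult_mono nb) (simp_all add: Suc_le_eq)
    also have "2 ^ q * 2 ^ b * 2 ^ q < (2::nat) ^ (2 * q + b + 1)"
      by (simp add: power_add mult_2)
    finally show "(\<Sum>j=1..n. p j) < 2 ^ (2 * q + b + 1)" by simp
    \<comment> \<open>Rounding up in \<open>b\<close> and the extra 1 for strictness cost at most 2,
      so \<open>K\<close> is at most twice the sum of the logarithms plus 2.\<close>
    show "real (2 * q + b + 1) \<le> 4 * max 1 (log 2 (P_max n p) + log 2 (n_max n p))"
      unfolding logP using b(2) log0 by (simp add: max_def)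
  qed simp
qed

theorem theoremA1:
  "\<exists>C::real. \<forall>(m::nat) (n::nat) (r::nat \<Rightarrow> real) (p::nat \<Rightarrow> nat) (a::nat \<Rightarrow> nat \<times> nat).
     1 \<le> m \<longrightarrow> 1 \<le> n \<longrightarrow> valid_instance n r p \<longrightarrow> alg_run m n r p a \<longrightarrow>
     (\<Sum>j=1..n. alg_completion p a j)
       \<le> C * max 1 (log 2 (P_max n p) + log 2 (n_max n p)) * OPT m n r p"
proof (intro exI[of _ 36] allI impI)
  fix m n :: nat and r :: "nat \<Rightarrow> real" and p :: "nat \<Rightarrow> nat" and a :: "nat \<Rightarrow> nat \<times> nat"
  assume m: "1 \<le> m" and n: "1 \<le> n" and inst: "valid_instance n r p" and run: "alg_run m n r p a"
  define M where "M = max 1 (log 2 (P_max n p) + log 2 (n_max n p))"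
  obtain K where K: "1 \<le> K" "(\<Sum>j=1..n. p j) < 2 ^ K" "real K \<le> 4 * M"
    using total_size_bound[OF n inst] unfolding M_def .
  let ?F = "4 * (2 * real K + 1)"
  have M: "1 \<le> M" by (simp add: M_def)
  \<comment> \<open>The constant 36 arises from \<open>4 * (2 * (4 * M) + 1) <= 36 * M\<close>,
    using \<open>1 <= M\<close>.\<close>
  have F: "0 < ?F" "?F \<le> 36 * M" using K(3) M by simp_all
  have "(\<Sum>j=1..n. alg_completion p a j) / (36 * M) \<le> OPT m n r p"
    unfolding OPT_def
  proof (rule cInf_greatest)
    show "{\<Sum>j=1..n. completion m p \<sigma> j | \<sigma>. feasible m n r p \<sigma>} \<noteq> {}"
      using feasible_exists[OF m inst] by blast
  next
    fix y assume "y \<in> {\<Sum>j=1..n. completion m p \<sigma> j | \<sigma>. feasible m n r p \<sigma>}"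
    then obtain \<sigma> where feas: "feasible m n r p \<sigma>" and y: "y = (\<Sum>j=1..n. completion m p \<sigma> j)"
      by blast
    have "0 \<le> completion m p \<sigma> j" if "j \<in> {1..n}" for j
      using completion_ge[OF feas that] valid_instanceD[OF inst that] by simp
    then have "0 \<le> y" unfolding y by (rule sum_nonneg)
    have "(\<Sum>j=1..n. alg_completion p a j) \<le> (\<Sum>j=1..n. ?F * completion m p \<sigma> j)"
    proof (rule sum_le_sum_if_counts_le)
      fix t
      \<comment> \<open>Counting scaled completion times up to \<open>t\<close> is counting unscaled
        ones up to \<open>t / ?F\<close>, where the stretch factor cancels.\<close>
      have "?F * c \<le> t \<longleftrightarrow> c \<le> t / ?F" for c
        using F(1) by (simp add: pos_le_divide_eq mult.commute)
      then show "card {j \<in> {1..n}. ?F * completion m p \<sigma> j \<le> t}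
          \<le> card {j \<in> {1..n}. alg_completion p a j \<le> t}"
        using alg_count_ge_opt_count[OF m run inst feas K(1,2), of "t / ?F"] F(1) by simp
    qed auto
    also have "\<dots> = ?F * y" by (simp add: y sum_distrib_left)
    also have "\<dots> \<le> 36 * M * y" using F(2) \<open>0 \<le> y\<close> by (rule mult_right_mono)
    finally show "(\<Sum>j=1..n. alg_completion p a j) / (36 * M) \<le> y"
      using M by (simp add: pos_divide_le_eq mult.commute)
  qed
  then show "(\<Sum>j=1..n. alg_completion p a j)
      \<le> 36 * max 1 (log 2 (P_max n p) + log 2 (n_max n p)) * OPT m n r p"
    unfolding M_def[symmetric] using M by (simp add: pos_divide_le_eq mult.commute)
qed

end
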